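(* Let $N,T\ge 1$ be integers and $\delta\in(0,1)$. Let $y_1,\dots,y_T\in\{0,1\}$ be outcomes and let $p_1,\dots,p_T\in[0,1]$ be the predictions generated by running kernel Defensive Forecasting with the Fermi–Sobolev kernel $$k_{\mathrm{FS}}(p,p')=\tfrac12\min(p,p')^2+\tfrac12\min(1-p,1-p')^2+\tfrac56 .$$ For each $t$, reveal the randomized forecast $$\mathrm{Round}_N(p_t)=\frac1N\begin{cases}\lfloor Np_t\rfloor & \text{with probability } 1-\operatorname{frac}(Np_t),\\ \lfloor Np_t\rfloor+1 & \text{with probability } \operatorname{frac}(Np_t),\end{cases}$$ with the roundings independent across $t$. Then, with probability at least $1-\delta$ over the rounding procedure (the sequences $(p_t)$ and $(y_t)$ being fixed), for all integers $n$ between $0$ and $N$, $$\left|\sum_{t=1}^T\mathbf{1}\{\mathrm{Round}_N(p_t)=\tfrac nN\}\left(\tfrac nN-y_t\right)\right|\le\sqrt{T}\left(\sqrt{\frac{8N+2}{3}}+\sqrt{2\log\big(2(N+1)/\delta\big)}\right)+\frac{T}{2N}.$$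
   Context: $\lfloor x\rfloor$ is the floor of $x$ and $\operatorname{frac}(x)=x-\lfloor x\rfloor$ its fractional part. Anticorrelation search: given $S:[0,1]\to\mathbb{R}$, return $p=1$ if $S(1)\ge 0$; otherwise return $p=0$ if $S(0)\le 0$; otherwise return some $p\in[0,1]$ with $S(p)=0$ (exact root finding). Kernel Defensive Forecasting with the kernel $k_{\mathrm{FS}}$: at each round $t$, define $S_t(p)=\sum_{i=1}^{t-1}k_{\mathrm{FS}}(p,p_i)(y_i-p_i)$ (so $S_1\equiv 0$), let $p_t$ be the output of anticorrelation search on $S_t$, and then observe $y_t\in\{0,1\}$. The algorithm uses the unrounded predictions $p_i$ in $S_t$. *)

theory Defs
  imports "HOL-Probability.Probability"
begin

definition k_FS :: "real \<Rightarrow> real \<Rightarrow> real" where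
  "k_FS p p' = (1/2) * (min p p')\<^sup>2 + (1/2) * (min (1 - p) (1 - p'))\<^sup>2 + 5/6"

(* Anticorrelation search may return any root in its last branch, so it is modelled
   as the relation "p is a possible output on input S". Only the values of S on the
   interval [0,1] matter. *)
definition anticorrelation_search :: "(real \<Rightarrow> real) \<Rightarrow> real \<Rightarrow> bool" where
  "anticorrelation_search S p \<longleftrightarrow>
     (if S 1 \<ge> 0 then p = 1
      else if S 0 \<le> 0 then p = 0
      else p \<in> {0..1} \<and> S p = 0)"

lemma anticorrelation_search_range: "anticorrelation_search S p \<Longrightarrow> p \<in> {0..1}"
  by (auto simp: anticorrelation_search_def split: if_splits)

definition score :: "(real \<Rightarrow> real \<Rightarrow> real) \<Rightarrow> (nat \<Rightarrow> real) \<Rightarrow> (nat \<Rightarrow> real) \<Rightarrow> nat \<Rightarrow> real \<Rightarrow> real" where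
  "score k p y t q = (\<Sum>i\<in>{1..<t}. k q (p i) * (y i - p i))"

(* p 1, ..., p T is a possible run of the algorithm against outcomes y 1, ..., y T;
   rounds are numbered from 1, and values at other indices are irrelevant. *)
definition kernel_defensive_forecasting ::
  "(real \<Rightarrow> real \<Rightarrow> real) \<Rightarrow> nat \<Rightarrow> (nat \<Rightarrow> real) \<Rightarrow> (nat \<Rightarrow> real) \<Rightarrow> bool" where
  "kernel_defensive_forecasting k T p y \<longleftrightarrow>
     (\<forall>t\<in>{1..T}. anticorrelation_search (score k p y t) (p t))"

(* The Boolean drawn decides whether to round up. *)
definition Round :: "nat \<Rightarrow> real \<Rightarrow> real pmf" where
  "Round N p =
     map_pmf (\<lambda>up. (1 / real N) * (if up then \<lfloor>real N * p\<rfloor> + 1 else \<lfloor>real N * p\<rfloor>))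
       (bernoulli_pmf (frac (real N * p)))"

(* Joint law of the independent roundings of p 1, ..., p T
   (outside {1..T} the sequence takes a dummy value). *)
definition roundings :: "nat \<Rightarrow> nat \<Rightarrow> (nat \<Rightarrow> real) \<Rightarrow> (nat \<Rightarrow> real) pmf" where
  "roundings N T p = Pi_pmf {1..T} 0 (\<lambda>t. Round N (p t))"

end

(* Round_N(p) equals n/N with probability hat N n p, the tent of width 2/N around n/N. Hoeffding's
   inequality and a union bound over n reduce the claim to the expected sums, in which replacing n/N
   by p_t costs at most T/(2N). What remains is a sum of hat(p_t) (p_t - y_t). Subtracting 1 from
   k_FS leaves the L2 inner product of the features x - [x > p], so Cauchy-Schwarz bounds this sum
   by the Fermi-Sobolev norm of hat (squared: at most 2N + 1/2) times the norm of the sum of the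
   (y_t - p_t) k_FS(p_t, .). The latter is at most sqrt(4T/3), since anticorrelation search makes
   the cross terms of its telescoped square nonpositive. *)
theory Submission imports Defs begin

section \<open>Feature map of the kernel and Cauchy-Schwarz\<close>

text \<open>Integration by parts shows that pairing this function with f' over [0,1] gives f(p)
  minus the mean of f. It therefore represents evaluation at p for the squared norm (mean of f)^2 +
  integral of f'^2; the mean accounts for the constant 1 split off from \<open>k_FS\<close>.\<close>

definition FS_feature :: "real \<Rightarrow> real \<Rightarrow> real" where
  "FS_feature p x = (if x \<le> p then x else x - 1)"

lemma has_integral_FS_feature_mult:
  assumes "p \<in> {0..1}" "q \<in> {0..1}"
  shows "((\<lambda>x. FS_feature p x * FS_feature q x) has_integral (k_FS p q - 1)) {0..1}"
  using assms
proof (induction p q rule: linorder_wlog)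
  case (le p q)
  let ?f = "\<lambda>x. FS_feature p x * FS_feature q x"
  have 1: "(?f has_integral (p ^ 3 / 3 - 0 ^ 3 / 3)) {0..p}"
    using le by (intro fundamental_theorem_of_calculus_interior)
      (auto simp: FS_feature_def power2_eq_square
        simp flip: has_real_derivative_iff_has_vector_derivative
        intro!: continuous_intros derivative_eq_intros)
  \<comment> \<open>At x = p the integrand takes the value from the left piece, so the integrand x(x
    - 1) is guaranteed only in the open interval. The same happens at q in the next piece; hence the
    interior form of the fundamental theorem.\<close>
  have 2: "(?f has_integral ((q ^ 3 / 3 - q ^ 2 / 2) - (p ^ 3 / 3 - p ^ 2 / 2))) {p..q}"
    using le by (intro fundamental_theorem_of_calculus_interior)
      (auto simp: FS_feature_def power2_eq_square algebra_simps
        simp flip: has_real_derivative_iff_has_vector_derivative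
        intro!: continuous_intros derivative_eq_intros)
  have 3: "(?f has_integral ((1 - 1) ^ 3 / 3 - (q - 1) ^ 3 / 3)) {q..1}"
    using le by (intro fundamental_theorem_of_calculus_interior)
      (auto simp: FS_feature_def power2_eq_square
        simp flip: has_real_derivative_iff_has_vector_derivative
        intro!: continuous_intros derivative_eq_intros)
  have "(?f has_integral ((p ^ 3 / 3 - 0 ^ 3 / 3)
      + ((q ^ 3 / 3 - q ^ 2 / 2) - (p ^ 3 / 3 - p ^ 2 / 2))
      + ((1 - 1) ^ 3 / 3 - (q - 1) ^ 3 / 3))) {0..1}"
    by (intro has_integral_combine[where c = q] has_integral_combine[where c = p] 1 2 3)
      (use le in auto)
  also have "((p ^ 3 / 3 - 0 ^ 3 / 3) + ((q ^ 3 / 3 - q ^ 2 / 2) - (p ^ 3 / 3 - p ^ 2 / 2))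
      + ((1 - 1) ^ 3 / 3 - (q - 1) ^ 3 / 3)) = k_FS p q - 1"
    using le by (simp add: k_FS_def min_def power2_eq_square power3_eq_cube field_simps)
  finally show ?case .
next
  case (sym p q)
  then show ?case
    by (simp add: k_FS_def mult.commute min.commute)
qed

lemma has_integral_FS_feature_sum_mult:
  assumes "finite I" "finite J"
    and "\<And>i. i \<in> I \<Longrightarrow> p i \<in> {0..1}" and "\<And>j. j \<in> J \<Longrightarrow> q j \<in> {0..1}"
  shows "((\<lambda>x. (\<Sum>i\<in>I. c i * FS_feature (p i) x) * (\<Sum>j\<in>J. a j * FS_feature (q j) x))
    has_integral (\<Sum>i\<in>I. \<Sum>j\<in>J. c i * a j * (k_FS (p i) (q j) - 1))) {0..1}"
proof -
  have "((\<lambda>x. \<Sum>i\<in>I. \<Sum>j\<in>J. c i * a j * (FS_feature (p i) x * FS_feature (q j) x))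
    has_integral (\<Sum>i\<in>I. \<Sum>j\<in>J. c i * a j * (k_FS (p i) (q j) - 1))) {0..1}"
    using assms by (intro has_integral_sum has_integral_mult_right has_integral_FS_feature_mult) auto
  then show ?thesis
    by (simp add: sum_product mult_ac)
qed

lemma nonneg_quadratic_discriminant:
  fixes A B C :: real
  assumes "\<And>x. 0 \<le> A + 2 * x * B + x\<^sup>2 * C"
  shows "B\<^sup>2 \<le> C * A"
proof (cases "C = 0")
  case True
  have "B = 0"
  proof (rule ccontr)
    assume "B \<noteq> 0"
    \<comment> \<open>This witness gives the affine function A + 2xB the value -1.\<close>
    then have "2 * (- (A + 1) / (2 * B)) * B = - (A + 1)"
      by simp
    with assms[of "- (A + 1) / (2 * B)"] True show False
      by simp
  qed
  with True show ?thesis by simp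
next
  case False
  have "C > 0"
  proof (rule ccontr)
    assume "\<not> C > 0"
    with False have C: "C < 0" by simp
    \<comment> \<open>For x >= 1, A + 2xB is at most x(|A| + 2|B|). The choice also pushes x * C
      below -(|A| + 2|B|), so the quadratic is negative at x.\<close>
    define x where "x = (1 + \<bar>A\<bar> + 2 * \<bar>B\<bar>) / (- C) + 1"
    have x: "x \<ge> 1" using C by (simp add: x_def field_simps)
    have "x * C = - (1 + \<bar>A\<bar> + 2 * \<bar>B\<bar>) + C" using C by (simp add: x_def field_simps)
    then have "x * C < - \<bar>A\<bar> - 2 * \<bar>B\<bar>" using C by linarith
    then have "x * (x * C) < x * (- \<bar>A\<bar> - 2 * \<bar>B\<bar>)" using x by simp
    moreover have "A \<le> x * \<bar>A\<bar>" using x mult_right_mono[of 1 x "\<bar>A\<bar>"] by simp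
    moreover have "x * B \<le> x * \<bar>B\<bar>" using x by (intro mult_left_mono) auto
    ultimately show False using assms[of x] by (simp add: algebra_simps power2_eq_square)
  qed
  \<comment> \<open>For C > 0 the minimum is attained at -B/C and equals A - B^2/C.\<close>
  with assms[of "- B / C"] show ?thesis
    by (simp add: field_simps power2_eq_square)
qed

text \<open>This is Cauchy-Schwarz in the product of the reals with L2[0,1], for the vectors
  (\<open>m\<close>, \<open>?F\<close>) and (\<open>sum c I\<close>, \<open>?D\<close>). No Hilbert
  space has to be built: the squared norm of the second vector plus x times the first is nonnegative
  for every x, and the discriminant gives the inequality.\<close>

lemma k_FS_Cauchy_Schwarz:
  fixes m :: real
  assumes "finite I" "finite J"
    and p: "\<And>i. i \<in> I \<Longrightarrow> p i \<in> {0..1}" and q: "\<And>j. j \<in> J \<Longrightarrow> q j \<in> {0..1}"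
  shows "(\<Sum>i\<in>I. c i * (m + (\<Sum>j\<in>J. a j * (k_FS (p i) (q j) - 1))))\<^sup>2
    \<le> (m\<^sup>2 + (\<Sum>j\<in>J. \<Sum>l\<in>J. a j * a l * (k_FS (q j) (q l) - 1)))
      * (\<Sum>i\<in>I. \<Sum>l\<in>I. c i * c l * k_FS (p i) (p l))"
proof (rule nonneg_quadratic_discriminant)
  fix x :: real
  let ?D = "\<lambda>u. \<Sum>i\<in>I. c i * FS_feature (p i) u"
  let ?F = "\<lambda>u. \<Sum>j\<in>J. a j * FS_feature (q j) u"
  let ?DD = "\<Sum>i\<in>I. \<Sum>l\<in>I. c i * c l * (k_FS (p i) (p l) - 1)"
  let ?DF = "\<Sum>i\<in>I. \<Sum>j\<in>J. c i * a j * (k_FS (p i) (q j) - 1)"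
  let ?FF = "\<Sum>j\<in>J. \<Sum>l\<in>J. a j * a l * (k_FS (q j) (q l) - 1)"
  let ?KK = "\<Sum>i\<in>I. \<Sum>l\<in>I. c i * c l * k_FS (p i) (p l)"
  have "((\<lambda>u. ?D u * ?D u + 2 * x * (?D u * ?F u) + x\<^sup>2 * (?F u * ?F u))
      has_integral (?DD + 2 * x * ?DF + x\<^sup>2 * ?FF)) {0..1}"
    using assms by (intro has_integral_add has_integral_mult_right has_integral_FS_feature_sum_mult)
  then have "0 \<le> ?DD + 2 * x * ?DF + x\<^sup>2 * ?FF"
  proof (rule has_integral_nonneg)
    fix u :: real
    have "0 \<le> (?D u + x * ?F u)\<^sup>2" by simp
    then show "0 \<le> ?D u * ?D u + 2 * x * (?D u * ?F u) + x\<^sup>2 * (?F u * ?F u)"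
      by (simp add: power2_eq_square algebra_simps)
  qed
  moreover have "0 \<le> (sum c I + x * m)\<^sup>2" by simp
  \<comment> \<open>The constant 1 removed from every kernel value sums to the squared scalar
    component.\<close>
  moreover have "?DD = ?KK - (sum c I)\<^sup>2"
    by (simp add: power2_eq_square sum_product algebra_simps sum_subtractf)
  moreover have "(\<Sum>i\<in>I. c i * (m + (\<Sum>j\<in>J. a j * (k_FS (p i) (q j) - 1)))) = sum c I * m + ?DF"
    by (simp add: distrib_left sum.distrib sum_distrib_left sum_distrib_right mult_ac)
  ultimately show "0 \<le> ?KK
      + 2 * x * (\<Sum>i\<in>I. c i * (m + (\<Sum>j\<in>J. a j * (k_FS (p i) (q j) - 1))))
      + x\<^sup>2 * (m\<^sup>2 + ?FF)"
    by (simp add: power2_eq_square algebra_simps)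
qed

section \<open>Energy bound for defensive forecasting\<close>

text \<open>The search outputs an endpoint only when the sign of S there opposes the possible signs
  of y - p: S(1) >= 0 meets y - 1 <= 0, and S(0) <= 0 meets y >= 0. Otherwise p is a root.\<close>

lemma anticorrelation_search_nonpos:
  assumes "anticorrelation_search S p" "y \<in> {0, 1::real}"
  shows "S p * (y - p) \<le> 0"
  using assms by (auto simp: anticorrelation_search_def mult_le_0_iff split: if_splits)

lemma k_FS_diag_le:
  assumes "p \<in> {0..1}"
  shows "k_FS p p \<le> 4 / 3"
proof -
  have "p * p \<le> p" using assms mult_left_le[of p p] by auto
  moreover have "k_FS p p = p * p - p + 4 / 3"
    by (simp add: k_FS_def power2_eq_square field_simps)
  ultimately show ?thesis by simp
qed

lemma k_FS_nonneg: "0 \<le> k_FS p q"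
  by (simp add: k_FS_def)

lemma k_FS_commute: "k_FS p q = k_FS q p"
  by (simp add: k_FS_def min.commute)

text \<open>The double sum is the squared norm of the sum of the (y_i - p_i) k_FS(p_i, .). A new
  round adds twice a cross term, which is the score at the prediction times the residual and hence
  nonpositive, and a diagonal term of at most 4/3.\<close>

lemma kernel_defensive_forecasting_energy:
  assumes "kernel_defensive_forecasting k_FS T p y" "\<And>t. t \<in> {1..T} \<Longrightarrow> y t \<in> {0, 1}"
  shows "(\<Sum>i=1..T. \<Sum>j=1..T. (y i - p i) * (y j - p j) * k_FS (p i) (p j)) \<le> 4 / 3 * real T"
  using assms
proof (induction T)
  case (Suc T)
  let ?c = "\<lambda>i. y i - p i"
  let ?t = "Suc T"
  have IH: "(\<Sum>i=1..T. \<Sum>j=1..T. ?c i * ?c j * k_FS (p i) (p j)) \<le> 4 / 3 * real T"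
    using Suc by (auto simp: kernel_defensive_forecasting_def)
  have anti: "anticorrelation_search (score k_FS p y ?t) (p ?t)"
    using Suc.prems by (auto simp: kernel_defensive_forecasting_def)
  have yt: "y ?t \<in> {0, 1}"
    using Suc.prems(2)[of ?t] by simp
  have pt: "p ?t \<in> {0..1}"
    using anti by (rule anticorrelation_search_range)
  have "score k_FS p y ?t (p ?t) * ?c ?t \<le> 0"
    using anti yt by (rule anticorrelation_search_nonpos)
  moreover have swap: "(\<Sum>j=1..T. ?c ?t * ?c j * k_FS (p ?t) (p j)) = (\<Sum>i=1..T. ?c i * ?c ?t * k_FS (p i) (p ?t))"
    by (intro sum.cong) (auto simp: k_FS_commute)
  moreover have "score k_FS p y ?t (p ?t) * ?c ?t = (\<Sum>i=1..T. ?c i * ?c ?t * k_FS (p i) (p ?t))"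
    unfolding score_def sum_distrib_right
    by (intro sum.cong) (auto simp: k_FS_commute)
  moreover have "?c ?t * ?c ?t * k_FS (p ?t) (p ?t) \<le> 1 * (4 / 3)"
    using yt pt by (intro mult_mono k_FS_diag_le k_FS_nonneg) (auto intro: mult_le_one)
  moreover have "(\<Sum>i=1..?t. \<Sum>j=1..?t. ?c i * ?c j * k_FS (p i) (p j))
    = (\<Sum>i=1..T. \<Sum>j=1..T. ?c i * ?c j * k_FS (p i) (p j))
      + 2 * (\<Sum>i=1..T. ?c i * ?c ?t * k_FS (p i) (p ?t)) + ?c ?t * ?c ?t * k_FS (p ?t) (p ?t)"
    using swap by (simp add: sum.distrib)
  ultimately show ?case
    using IH by simp
qed simp

section \<open>Tent functions in the Fermi-Sobolev space\<close>

definition hat :: "nat \<Rightarrow> nat \<Rightarrow> real \<Rightarrow> real" where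
  "hat N n p = max 0 (1 - \<bar>real N * p - real n\<bar>)"

(* The hat function is piecewise linear, so it is its mean plus a combination of sections of
   k_FS at its kinks, with coefficients the negated slope jumps. For n = 0 and n = N the missing
   neighbour is clamped to the endpoint. *)
lemma hat_k_FS_expansion:
  assumes "N \<ge> 1" "n \<le> N"
  obtains m :: real and a q :: "nat \<Rightarrow> real" where
    "\<And>j. j < 3 \<Longrightarrow> q j \<in> {0..1}"
    "\<And>p. p \<in> {0..1} \<Longrightarrow> hat N n p = m + (\<Sum>j<3. a j * (k_FS p (q j) - 1))"
    "0 \<le> m\<^sup>2 + (\<Sum>j<3. \<Sum>l<3. a j * a l * (k_FS (q j) (q l) - 1))"
    "m\<^sup>2 + (\<Sum>j<3. \<Sum>l<3. a j * a l * (k_FS (q j) (q l) - 1)) \<le> 2 * real N + 1 / 2"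
proof -
  define h where "h = 1 / real N"
  define s where "s = real n * h"
  have N: "real N \<ge> 1" and Nh: "real N * h = 1" and h: "0 < h" "h \<le> 1"
    using assms by (auto simp: h_def)
  have "real n \<le> real N" using assms by simp
  then have s: "0 \<le> s" "s \<le> 1" "real N * s = real n"
    using assms by (auto simp: s_def h_def field_simps)
  \<comment> \<open>Left end, right end and interior of the grid. An interior point forces N >= 2,
    whence h <= 1/2.\<close>
  have s_cases: "s = 0 \<and> n \<noteq> N \<or> s = 1 \<and> n = N \<or> h \<le> s \<and> s + h \<le> 1 \<and> n \<noteq> N \<and> h \<le> 1/2"
  proof -
    consider "n = 0" | "n = N" "n \<noteq> 0" | "1 \<le> n" "n + 1 \<le> N" using assms by linarith
    then show ?thesis
    proof cases
      case 3
      then have "1 \<le> real n" "real n + 1 \<le> real N" by linarith+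
      with 3 show ?thesis by (auto simp: s_def h_def field_simps)
    qed (use assms in \<open>auto simp: s_def h_def\<close>)
  qed
  define lo where "lo = max 0 (s - h)"
  define hi where "hi = min 1 (s + h)"
  \<comment> \<open>At p = 1 all the terms max p v coincide and their second difference vanishes, so
    \<open>e\<close> has to be the value of the tent at 1.\<close>
  define e :: real where "e = of_bool (n = N)"
  define q where "q = (\<lambda>j. [lo, s, hi] ! j)"
  define a where "a = (\<lambda>j. [- real N, 2 * real N, - real N] ! j)"
  \<comment> \<open>The coefficients in \<open>a\<close> sum to zero, so in the expansion
    \<open>k\<close> below the terms 1/3 and u^2/2 cancel. What remains of the v^2/2 terms is
    compensated by \<open>m\<close>, which is the mean of the tent.\<close>
  define m where "m = e + real N / 2 * (lo\<^sup>2 - 2 * s\<^sup>2 + hi\<^sup>2)"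
  have k: "k_FS u v - 1 = 1/3 + u\<^sup>2/2 + v\<^sup>2/2 - max u v" for u v
    by (simp add: k_FS_def min_def max_def power2_eq_square field_simps)
  have lohi: "0 \<le> lo" "lo \<le> s" "s \<le> hi" "hi \<le> 1" 
    using s h by (auto simp: lo_def hi_def)
  have sum3: "(\<Sum>j<3. f j) = f 0 + f 1 + f (2::nat)" for f :: "nat \<Rightarrow> real"
    by (simp add: numeral_3_eq_3 numeral_2_eq_2)
  \<comment> \<open>This is the integral of the squared slope: N on the left of s, -N on the
    right.\<close>
  have V: "(\<Sum>j<3. \<Sum>l<3. a j * a l * (k_FS (q j) (q l) - 1)) = (real N)\<^sup>2 * (hi - lo)"
    using lohi by (simp add: k sum3 a_def q_def max_def power2_eq_square algebra_simps)
  \<comment> \<open>The mean is h/2 at an end of the grid and h inside. The squared slope integrates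
    to N and 2N respectively; at an end N >= 1 leaves ample room, and inside h^2 <= 1/4.\<close>
  have V_le: "m\<^sup>2 + (real N)\<^sup>2 * (hi - lo) \<le> 2 * real N + 1 / 2"
    using s_cases
  proof (elim disjE conjE)
    assume *: "s = 0" "n \<noteq> N"
    then have "m = h / 2" and "(real N)\<^sup>2 * (hi - lo) = real N"
      using h Nh by (auto simp: m_def e_def lo_def hi_def power2_eq_square algebra_simps)
    moreover have "h * h \<le> 1" using h by (intro mult_le_one) auto
    moreover have "m\<^sup>2 = h * h / 4" by (subst \<open>m = h / 2\<close>) (simp add: power2_eq_square)
    ultimately show ?thesis using N by linarith
  next
    assume *: "s = 1" "n = N"
    then have eq: "lo = 1 - h" "hi = 1" using h by (auto simp: lo_def hi_def)
    have "m = 1 + (real N * h * h - 2 * (real N * h)) / 2"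
      using * by (simp add: m_def e_def eq power2_eq_square field_simps)
    then have "m = h / 2" using Nh by (simp add: field_simps)
    moreover have "(real N)\<^sup>2 * (hi - lo) = real N"
      using Nh by (simp add: eq power2_eq_square)
    moreover have "h * h \<le> 1" using h by (intro mult_le_one) auto
    moreover have "m\<^sup>2 = h * h / 4" by (subst \<open>m = h / 2\<close>) (simp add: power2_eq_square)
    ultimately show ?thesis using N by linarith
  next
    assume *: "h \<le> s" "s + h \<le> 1" "n \<noteq> N" "h \<le> 1 / 2"
    then have eq: "lo = s - h" "hi = s + h" using h by (auto simp: lo_def hi_def)
    have "m = real N * h * h"
      using * by (simp add: m_def e_def eq power2_eq_square algebra_simps)
    then have "m = h" using Nh by simp
    moreover have "(real N)\<^sup>2 * (hi - lo) = 2 * real N"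
      using Nh by (simp add: eq power2_eq_square)
    moreover have "h * h \<le> 1/2 * (1/2)" using h * by (intro mult_mono) auto
    moreover have "m\<^sup>2 = h * h" by (subst \<open>m = h\<close>) (simp add: power2_eq_square)
    ultimately show ?thesis by linarith
  qed
  show thesis
  proof (rule that[of q m a])
    show "q j \<in> {0..1}" if "j < 3" for j
    proof -
      from that consider "j = 0" | "j = 1" | "j = 2" by linarith
      then show ?thesis using lohi s by cases (auto simp: q_def)
    qed
    show "0 \<le> m\<^sup>2 + (\<Sum>j<3. \<Sum>l<3. a j * a l * (k_FS (q j) (q l) - 1))"
      using lohi by (simp add: V)
    show "m\<^sup>2 + (\<Sum>j<3. \<Sum>l<3. a j * a l * (k_FS (q j) (q l) - 1)) \<le> 2 * real N + 1 / 2"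
      using V_le by (simp add: V)
    fix p :: real assume p: "p \<in> {0..1}"
    have "m + (\<Sum>j<3. a j * (k_FS p (q j) - 1))
        = e + real N * (max p lo - 2 * max p s + max p hi)"
      by (simp add: k sum3 a_def q_def m_def power2_eq_square algebra_simps)
    also have "\<dots> = e + real N * max p lo - 2 * (real N * max p s) + real N * max p hi"
      by (simp add: algebra_simps)
    also have "\<dots> = hat N n p"
    proof -
      have mx: "real N * max u v = max (real N * u) (real N * v)" for u v
        using N by (simp add: max_def)
      have Np: "0 \<le> real N * p" "real N * p \<le> real N" using p by (auto intro: mult_left_le)
      have Ns: "real N * (s + h) = real n + 1" "real N * (s - h) = real n - 1"
        using s Nh by (auto simp: algebra_simps)
      from s_cases show ?thesis
      proof (elim disjE conjE)
        assume *: "s = 0" "n \<noteq> N"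
        then have "n = 0" "lo = 0" "hi = h" using s h by (auto simp: lo_def hi_def)
        moreover have "real N * max p h = max (real N * p) 1" by (simp add: mx Nh)
        moreover have "max p 0 = p" using p by simp
        ultimately show ?thesis using * Np by (simp add: e_def hat_def max_def mult.commute)
      next
        assume *: "s = 1" "n = N"
        then have "lo = s - h" "hi = 1" using h by (auto simp: lo_def hi_def)
        then show ?thesis using * Np Nh Ns by (auto simp: mx e_def hat_def)
      next
        assume *: "h \<le> s" "s + h \<le> 1" "n \<noteq> N"
        then have "lo = s - h" "hi = s + h" using h by (auto simp: lo_def hi_def)
        then show ?thesis using * Np s Ns by (auto simp: mx e_def hat_def)
      qed
    qed
    finally show "hat N n p = m + (\<Sum>j<3. a j * (k_FS p (q j) - 1))" by simp
  qed
qed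

text \<open>Cauchy-Schwarz with coefficients y_t - p_t multiplies the squared norm of the tent by
  the energy, and (2N + 1/2) * (4/3) T = T (8N + 2)/3.\<close>

lemma kernel_defensive_forecasting_hat:
  assumes "N \<ge> 1" "n \<le> N"
    and KDF: "kernel_defensive_forecasting k_FS T p y"
    and y: "\<And>t. t \<in> {1..T} \<Longrightarrow> y t \<in> {0, 1}"
  shows "\<bar>\<Sum>t=1..T. hat N n (p t) * (p t - y t)\<bar> \<le> sqrt (real T) * sqrt ((8 * real N + 2) / 3)"
proof -
  have p: "p t \<in> {0..1}" if "t \<in> {1..T}" for t
    using KDF that unfolding kernel_defensive_forecasting_def
    by (blast intro: anticorrelation_search_range)
  obtain m and a q :: "nat \<Rightarrow> real" where q: "\<And>j. j < 3 \<Longrightarrow> q j \<in> {0..1}"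
    and hat: "\<And>p. p \<in> {0..1} \<Longrightarrow> hat N n p = m + (\<Sum>j<3. a j * (k_FS p (q j) - 1))"
    and V0: "0 \<le> m\<^sup>2 + (\<Sum>j<3. \<Sum>l<3. a j * a l * (k_FS (q j) (q l) - 1))" 
    and V1: "m\<^sup>2 + (\<Sum>j<3. \<Sum>l<3. a j * a l * (k_FS (q j) (q l) - 1)) \<le> 2 * real N + 1 / 2"
    by (rule hat_k_FS_expansion[OF assms(1,2)]) (rule that)
  let ?V = "m\<^sup>2 + (\<Sum>j<3. \<Sum>l<3. a j * a l * (k_FS (q j) (q l) - 1))"
  let ?K = "\<Sum>i=1..T. \<Sum>j=1..T. (y i - p i) * (y j - p j) * k_FS (p i) (p j)"
  have "(\<Sum>t=1..T. hat N n (p t) * (p t - y t)) =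
      - (\<Sum>t=1..T. (y t - p t) * (m + (\<Sum>j<3. a j * (k_FS (p t) (q j) - 1))))"
    unfolding sum_negf[symmetric] using p by (intro sum.cong) (auto simp: hat algebra_simps)
  then have "(\<Sum>t=1..T. hat N n (p t) * (p t - y t))\<^sup>2
      = (\<Sum>t=1..T. (y t - p t) * (m + (\<Sum>j<3. a j * (k_FS (p t) (q j) - 1))))\<^sup>2"
    by simp
  also have "\<dots> \<le> ?V * ?K"
    using p q by (intro k_FS_Cauchy_Schwarz) auto
  also have "\<dots> \<le> ?V * (4 / 3 * real T)"
    using V0 KDF y by (intro mult_left_mono kernel_defensive_forecasting_energy)
  also have "\<dots> \<le> (2 * real N + 1 / 2) * (4 / 3 * real T)"
    using V1 by (intro mult_right_mono) auto
  also have "\<dots> = real T * ((8 * real N + 2) / 3)"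
    by (simp add: field_simps)
  finally show ?thesis
    by (metis real_sqrt_abs real_sqrt_le_mono real_sqrt_mult)
qed

section \<open>Law, bias and concentration of the rounding\<close>

text \<open>The value n/N arises by rounding down from [n, n+1) or by rounding up from [n-1, n), in
  units of 1/N. The two probabilities are the falling and the rising side of the tent.\<close>

lemma prob_Round_eq:
  assumes "N \<ge> 1"
  shows "measure_pmf.prob (Round N p) {real n / real N} = hat N n p"
proof -
  let ?x = "real N * p"
  have eq: "(\<lambda>up. (1 / real N) * real_of_int (if up then \<lfloor>?x\<rfloor> + 1 else \<lfloor>?x\<rfloor>)) -` {real n / real N}
      = {up. (if up then \<lfloor>?x\<rfloor> + 1 else \<lfloor>?x\<rfloor>) = int n}"
    using assms by (auto simp: field_simps)
  have prob: "measure_pmf.prob (Round N p) {real n / real N} = measure_pmf.prob (bernoulli_pmf (frac ?x))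
      {up. (if up then \<lfloor>?x\<rfloor> + 1 else \<lfloor>?x\<rfloor>) = int n}"
    unfolding Round_def measure_map_pmf eq ..
  have fr: "0 \<le> frac ?x" "frac ?x < 1" "frac ?x = ?x - of_int \<lfloor>?x\<rfloor>"
    by (rule frac_ge_0 frac_lt_1 meta_eq_to_obj_eq[OF frac_def])+
  consider "\<lfloor>?x\<rfloor> = int n" | "\<lfloor>?x\<rfloor> + 1 = int n" | "\<lfloor>?x\<rfloor> \<noteq> int n" "\<lfloor>?x\<rfloor> + 1 \<noteq> int n"
    by blast
  then show ?thesis
  proof cases
    case 1
    then have "{up. (if up then \<lfloor>?x\<rfloor> + 1 else \<lfloor>?x\<rfloor>) = int n} = {False}"
      by (auto split: if_splits)
    then have "measure_pmf.prob (Round N p) {real n / real N} = 1 - frac ?x"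
      unfolding prob using fr(1,2) by (simp add: measure_pmf_single)
    also have "\<dots> = hat N n p" using 1 fr by (simp add: hat_def)
    finally show ?thesis .
  next
    case 2
    then have "{up. (if up then \<lfloor>?x\<rfloor> + 1 else \<lfloor>?x\<rfloor>) = int n} = {True}"
      by (auto split: if_splits)
    then have "measure_pmf.prob (Round N p) {real n / real N} = frac ?x"
      unfolding prob using fr(1,2) by (simp add: measure_pmf_single)
    also have "real_of_int \<lfloor>?x\<rfloor> = real n - 1" using 2 by linarith
    then have "frac ?x = hat N n p" using fr by (simp add: hat_def)
    finally show ?thesis .
  next
    case 3
    then have "{up. (if up then \<lfloor>?x\<rfloor> + 1 else \<lfloor>?x\<rfloor>) = int n} = {}"
      by (auto split: if_splits)
    then have "measure_pmf.prob (Round N p) {real n / real N} = 0"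
      by (simp add: prob)
    moreover have "hat N n p = 0"
      using 3 unfolding hat_def by linarith
    ultimately show ?thesis by simp
  qed
qed

lemma hat_mult_distance_le:
  assumes "N \<ge> 1"
  shows "\<bar>hat N n p * (real n / real N - p)\<bar> \<le> 1 / (2 * real N)"
proof -
  let ?u = "\<bar>real N * p - real n\<bar>"
  have N: "real N > 0" using assms by simp
  have "real n / real N - p = - (real N * p - real n) / real N"
    using N by (simp add: field_simps)
  then have "\<bar>hat N n p * (real n / real N - p)\<bar> = hat N n p * ?u / real N"
    using N by (simp add: abs_mult abs_minus_commute hat_def)
  also have "hat N n p * ?u \<le> 1 / 2"
  proof (cases "?u \<le> 1")
    case True
    \<comment> \<open>Completing the square bounds u(1 - u) by 1/4, which is within the required
      1/2.\<close>
    have "0 \<le> (?u - 1/2)\<^sup>2" by simp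
    then show ?thesis using True
      by (simp add: hat_def power2_eq_square algebra_simps)
  qed (simp add: hat_def)
  then have "hat N n p * ?u / real N \<le> 1 / 2 / real N"
    using N by (intro divide_right_mono) auto
  finally show ?thesis by simp
qed

lemma roundings_concentration:
  assumes "N \<ge> 1" "T \<ge> 1" "n \<le> N" "\<epsilon> \<ge> 0"
    and y: "\<And>t. t \<in> {1..T} \<Longrightarrow> y t \<in> {0, 1}"
  shows "measure_pmf.prob (roundings N T p)
    {r. \<epsilon> \<le> \<bar>(\<Sum>t=1..T. of_bool (r t = real n / real N) * (real n / real N - y t))
            - (\<Sum>t=1..T. hat N n (p t) * (real n / real N - y t))\<bar>}
    \<le> 2 * exp (- 2 * \<epsilon>\<^sup>2 / real T)"
proof -
  let ?M = "measure_pmf (roundings N T p)"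
  let ?v = "real n / real N"
  define X where "X = (\<lambda>t r. of_bool (r t = ?v) * (?v - y t))"
  have v: "0 \<le> ?v" "?v \<le> 1" using assms by auto
  have indep: "prob_space.indep_vars ?M (\<lambda>_. borel) X {1..T}"
    unfolding X_def roundings_def
    by (intro prob_space.indep_vars_compose2[OF _ indep_vars_Pi_pmf,
          where Y = "\<lambda>t z. of_bool (z = ?v) * (?v - y t)"])
       (auto simp: measure_pmf.prob_space_axioms)
  have E: "measure_pmf.expectation (roundings N T p) (X t) = hat N n (p t) * (?v - y t)"
    if "t \<in> {1..T}" for t
  proof -
    have "measure_pmf.expectation (roundings N T p) (X t)
        = measure_pmf.expectation (map_pmf (\<lambda>r. r t) (roundings N T p)) (\<lambda>z. indicator {?v} z * (?v - y t))"
      by (simp add: X_def indicator_def)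
    also have "map_pmf (\<lambda>r. r t) (roundings N T p) = Round N (p t)"
      using that by (simp add: roundings_def Pi_pmf_component)
    finally show ?thesis
      using assms(1) by (simp add: prob_Round_eq)
  qed
  \<comment> \<open>Each summand is 0 or n/N - y_t. Both lie in [-y_t, 1 - y_t], an interval of
    length 1, so the denominator in Hoeffding's exponent is T.\<close>
  interpret Hoeffding_ineq ?M "{1..T}" X "\<lambda>t. - y t" "\<lambda>t. 1 - y t"
      "\<Sum>t=1..T. measure_pmf.expectation (roundings N T p) (X t)"
    by unfold_locales (use indep y v in \<open>fastforce simp: X_def\<close>)+
  have "measure_pmf.prob (roundings N T p) {r \<in> space ?M. \<epsilon> \<le>
      \<bar>(\<Sum>t=1..T. X t r) - (\<Sum>t=1..T. measure_pmf.expectation (roundings N T p) (X t))\<bar>}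
      \<le> 2 * exp (- 2 * \<epsilon>\<^sup>2 / (\<Sum>t=1..T. ((1 - y t) - (- y t))\<^sup>2))"
    using assms by (intro Hoeffding_ineq_abs_ge) auto
  moreover have "(\<Sum>t=1..T. measure_pmf.expectation (roundings N T p) (X t))
      = (\<Sum>t=1..T. hat N n (p t) * (?v - y t))"
    by (intro sum.cong E refl)
  ultimately show ?thesis
    by (simp add: X_def)
qed

section \<open>Union bound over the grid\<close>

theorem proposition8p1:
  fixes N T :: nat and \<delta> :: real and p y :: "nat \<Rightarrow> real"
  assumes "N \<ge> 1" and "T \<ge> 1" and "0 < \<delta>" and "\<delta> < 1"
    and "\<And>t. t \<in> {1..T} \<Longrightarrow> y t \<in> {0, 1}"
    and "kernel_defensive_forecasting k_FS T p y"
  shows "measure_pmf.prob (roundings N T p)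
           {r. \<forall>n\<in>{0..N}.
                 \<bar>\<Sum>t=1..T. of_bool (r t = real n / real N) * (real n / real N - y t)\<bar>
                   \<le> sqrt (real T) * (sqrt ((8 * real N + 2) / 3)
                        + sqrt (2 * ln (2 * (real N + 1) / \<delta>)))
                      + real T / (2 * real N)}
         \<ge> 1 - \<delta>"
proof -
  let ?M = "roundings N T p"
  define L where "L = ln (2 * (real N + 1) / \<delta>)"
  define \<epsilon> where "\<epsilon> = sqrt (real T) * sqrt (2 * L)"
  define S where "S = (\<lambda>n r. \<Sum>t=1..T. of_bool (r t = real n / real N) * (real n / real N - y t))"
  define m where "m = (\<lambda>n. \<Sum>t=1..T. hat N n (p t) * (real n / real N - y t))"
  define B where "B = (\<lambda>n. {r. \<epsilon> \<le> \<bar>S n r - m n\<bar>})"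
  let ?G = "{r. \<forall>n\<in>{0..N}. \<bar>S n r\<bar> \<le> sqrt (real T) * (sqrt ((8 * real N + 2) / 3) + sqrt (2 * L))
                      + real T / (2 * real N)}"
  \<comment> \<open>This makes L nonnegative, so that the square of \<open>\<epsilon>\<close> really
    is 2LT.\<close>
  have "2 * (real N + 1) / \<delta> \<ge> 1"
    using assms(3,4) by (simp add: field_simps)
  then have L: "L \<ge> 0" and expL: "exp L = 2 * (real N + 1) / \<delta>"
    by (auto simp: L_def)
  have m_le: "\<bar>m n\<bar> \<le> sqrt (real T) * sqrt ((8 * real N + 2) / 3) + real T / (2 * real N)"
    if "n \<le> N" for n
  proof -
    \<comment> \<open>The error n/N - y_t splits into the forecaster's error p_t - y_t and the
      displacement n/N - p_t due to rounding.\<close>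
    have "m n = (\<Sum>t=1..T. hat N n (p t) * (p t - y t))
        + (\<Sum>t=1..T. hat N n (p t) * (real n / real N - p t))"
      by (simp add: m_def algebra_simps flip: sum.distrib)
    moreover have "\<bar>\<Sum>t=1..T. hat N n (p t) * (p t - y t)\<bar> \<le> sqrt (real T) * sqrt ((8 * real N + 2) / 3)"
      using assms that by (intro kernel_defensive_forecasting_hat)
    moreover have "\<bar>\<Sum>t=1..T. hat N n (p t) * (real n / real N - p t)\<bar> \<le> (\<Sum>t=1..T. 1 / (2 * real N))"
      using assms(1) by (intro order_trans[OF sum_abs] sum_mono hat_mult_distance_le)
    ultimately show ?thesis by simp
  qed
  \<comment> \<open>The bound in \<open>?G\<close> is the bound on |m n| plus
    \<open>\<epsilon>\<close>, so exceeding it forces a deviation from the mean of at least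
    \<open>\<epsilon>\<close>.\<close>
  have "UNIV - ?G \<subseteq> (\<Union>n\<in>{0..N}. B n)"
  proof
    fix r assume "r \<in> UNIV - ?G"
    then obtain n where n: "n \<in> {0..N}" and
      "\<bar>S n r\<bar> > sqrt (real T) * (sqrt ((8 * real N + 2) / 3) + sqrt (2 * L)) + real T / (2 * real N)"
      by (auto simp: not_le)
    with m_le[of n] have "r \<in> B n"
      by (simp add: B_def \<epsilon>_def algebra_simps)
    with n show "r \<in> (\<Union>n\<in>{0..N}. B n)" by blast
  qed
  then have "measure_pmf.prob ?M (UNIV - ?G) \<le> measure_pmf.prob ?M (\<Union>n\<in>{0..N}. B n)"
    by (intro measure_pmf.finite_measure_mono) auto
  also have "\<dots> \<le> (\<Sum>n\<in>{0..N}. measure_pmf.prob ?M (B n))"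
    by (intro measure_pmf.finite_measure_subadditive_finite) auto
  also have "\<dots> \<le> (\<Sum>n\<in>{0..N}. 2 * exp (- L))"
  proof (intro sum_mono)
    fix n assume "n \<in> {0..N}"
    then have "measure_pmf.prob ?M (B n) \<le> 2 * exp (- 2 * \<epsilon>\<^sup>2 / real T)"
      unfolding B_def S_def m_def using assms L by (intro roundings_concentration) (auto simp: \<epsilon>_def)
    also have "- 2 * \<epsilon>\<^sup>2 / real T = - 4 * L"
      using assms(2) L by (simp add: \<epsilon>_def power_mult_distrib)
    \<comment> \<open>Hoeffding yields more than is needed: exp(-L) = \<delta>/(2(N + 1)) already
      makes the N + 1 two-sided bounds add up to \<delta>.\<close>
    also have "2 * exp (- 4 * L) \<le> 2 * exp (- L)"
      using L by simp
    finally show "measure_pmf.prob ?M (B n) \<le> 2 * exp (- L)" .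
  qed
  also have "\<dots> = \<delta>"
    using assms(3) by (simp add: exp_minus expL field_simps)
  finally have "measure_pmf.prob ?M (UNIV - ?G) \<le> \<delta>" .
  moreover have "measure_pmf.prob ?M (UNIV - ?G) = 1 - measure_pmf.prob ?M ?G"
    using measure_pmf.prob_compl[of ?G ?M] by simp
  ultimately show ?thesis
    by (simp add: S_def L_def)
qed

end
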